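(* The generating function $G^{\mathrm v}(x)=\sum_{n\ge0}g^{\mathrm v}_{n+1}\frac{x^n}{n!}$ is \[ G^{\mathrm v}(x)=\frac{\sqrt\theta\bigl(-\sinh(2\sqrt\theta\,x)+\sqrt\theta\cosh(2\sqrt\theta\,x)+2\sqrt\theta\,x+\sqrt\theta\bigr)}{2\bigl(-\sinh(\sqrt\theta\,x)+\sqrt\theta\cosh(\sqrt\theta\,x)\bigr)^2}. \] Moreover, for every $n\ge2$, \[ g^{\mathrm v}_n=n(2\sqrt\theta)^n\sum_{j\ge1}j^{n-1}\frac{(1-\sqrt\theta)^{j-1}}{(1+\sqrt\theta)^{j+1}}. \]
   Context: $\mathcal S_n$ is the set of permutations of $[n]$. For $\pi\in\mathcal S_n$ written in standard cycle form (each cycle begins with its smallest element, cycles ordered left to right by increasing smallest elements), $\mathrm{Flatten}(\pi)$ is the word obtained by erasing the parentheses. For a word $w$, $\mathrm v(w)$ is the number of valleys, i.e. indices $i$ with $w_{i+1}=\min\{w_i,w_{i+1},w_{i+2}\}$. Let $g^{\mathrm v}_n=\sum_{\pi\in\mathcal S_n}q^{\mathrm v(\mathrm{Flatten}(\pi))}$, where $q$ is an indeterminate and $\theta=1-q$. *)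

theory Defs
  imports
    Complex_Main
    "HOL-Combinatorics.Cycles"
    "HOL-Computational_Algebra.Formal_Laurent_Series"
    "HOL-Computational_Algebra.Polynomial_FPS"
begin

text \<open>
  Standard cycle form of a permutation of \<open>{1..n}\<close>.  \<open>support p x\<close> is the cycle
  \<open>[x, p x, p (p x), \<dots>]\<close> of \<open>p\<close> through \<open>x\<close> (of length 1 when \<open>x\<close> is a fixed point); it is
  listed once, starting from its smallest element, and the cycles come in increasing order
  of these elements.
\<close>

definition standard_cycle_form :: "nat \<Rightarrow> (nat \<Rightarrow> nat) \<Rightarrow> nat list list" where
  "standard_cycle_form n p =
     map (support p) (filter (\<lambda>x. \<forall>y\<in>set (support p x). x \<le> y) [1..<Suc n])"

definition flatten :: "nat \<Rightarrow> (nat \<Rightarrow> nat) \<Rightarrow> nat list" where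
  "flatten n p = concat (standard_cycle_form n p)"

text \<open>Positions in a list are counted from 0.\<close>

definition valleys :: "'a::linorder list \<Rightarrow> nat" where
  "valleys w = card {i. i + 2 < length w \<and> w ! (i + 1) = Min {w ! i, w ! (i + 1), w ! (i + 2)}}"

definition valley_poly :: "nat \<Rightarrow> real poly" where
  "valley_poly n = (\<Sum>p | p permutes {1..n}. monom 1 (valleys (flatten n p)))"

text \<open>
  The indeterminate \<open>q\<close> is \<^term>\<open>fls_X\<close> in the field of formal Laurent series
  in \<open>q\<close> over the reals.  This field contains \<open>\<real>[q]\<close> and also the square root of \<open>1 - q\<close> with
  constant term 1.
\<close>

definition gv :: "nat \<Rightarrow> real fls" where
  "gv n = fps_to_fls (fps_of_poly (valley_poly n))"

definition sqrt_theta :: "real fls" where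
  "sqrt_theta = fps_to_fls (fps_radical root 2 (1 - fps_X))"

lemma sqrt_theta_squared: "sqrt_theta\<^sup>2 = 1 - fls_X"
proof -
  have "(fps_radical root 2 (1 - fps_X :: real fps))\<^sup>2 = 1 - fps_X"
    using power_radical[of "1 - fps_X :: real fps" root 1] by (simp add: numeral_2_eq_2)
  then have "fps_to_fls ((fps_radical root 2 (1 - fps_X :: real fps))\<^sup>2) = 1 - fls_X"
    by simp
  then show ?thesis
    by (simp add: sqrt_theta_def fps_to_fls_power)
qed

text \<open>\<open>fps_sinh c\<close> and \<open>fps_cosh c\<close> are the series of \<open>sinh (c x)\<close> and \<open>cosh (c x)\<close> in \<open>x\<close>.\<close>

definition fps_sinh :: "'a::field_char_0 \<Rightarrow> 'a fps" where
  "fps_sinh c = (fps_exp c - fps_exp (- c)) / 2"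

definition fps_cosh :: "'a::field_char_0 \<Rightarrow> 'a fps" where
  "fps_cosh c = (fps_exp c + fps_exp (- c)) / 2"

text \<open>The outer formal power series is in the variable \<open>x\<close>.\<close>

definition Gv :: "real fls fps" where
  "Gv = Abs_fps (\<lambda>n. gv (n + 1) / fact n)"

end

theory Submission
  imports Defs "HOL-Combinatorics.Multiset_Permutations"
begin

text \<open>
  Inserting the largest letter shows that a word \<open>1 # u\<close> is the flattening of \<open>2 ^ rl_minima u\<close>
  permutations, so the \<open>g\<close>-polynomials count words \<open>u\<close> by valleys, with weight \<open>2\<close> for every
  right-to-left minimum.  Splitting words at their smallest letter turns into differential
  equations: the unweighted generating function \<open>P\<close> (without its constant term) satisfies
  \<open>P' = 1 + 2 P + q P\<^sup>2\<close>, and the weighted one \<open>F\<close> satisfies \<open>F' = 2 (1 + P + F + q P F)\<close>.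
  The latter is linear in \<open>F\<close> and is solved by \<open>F = P + x P'\<close>.  The Riccati equation is solved by
  \<open>P = sinh (s x) / (s cosh (s x) - sinh (s x))\<close> with \<open>s\<^sup>2 = 1 - q\<close>.  Written in exponentials,
  \<open>P\<close> is up to a constant term a multiple of \<open>exp (2 s x) / (1 - r exp (2 s x))\<close> with
  \<open>r = (1 - s) / (1 + s)\<close>, whose expansion as a geometric series is the second formula.
\<close>

subsection \<open>Flattened permutations and right-to-left minima\<close>

text \<open>Iterating \<open>p\<close> from the head walks through the list and first returns after
  \<open>length xs\<close> steps, because the entries are distinct. So the cycle of a modified
  permutation can be found by exhibiting a list and checking one rotation.\<close>

lemma support_eqI:
  assumes "distinct xs" "xs \<noteq> []" "map p xs = rotate1 xs"
  shows "support p (hd xs) = xs"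
proof -
  let ?n = "length xs"
  have n: "?n > 0" using assms(2) by simp
  have step: "p (xs ! i) = xs ! (Suc i mod ?n)" if "i < ?n" for i
    using that assms(3) nth_rotate1[OF that] nth_map[OF that, of p] by simp
  have pow: "(p ^^ i) (hd xs) = xs ! (i mod ?n)" for i
  proof (induction i)
    case 0
    then show ?case using assms(2) by (simp add: hd_conv_nth)
  next
    case (Suc i)
    then show ?case using step[of "i mod ?n"] n by (simp add: mod_Suc_eq)
  qed
  have "least_power p (hd xs) = ?n"
    unfolding least_power_def
  proof (rule Least_equality)
    show "(p ^^ ?n) (hd xs) = hd xs \<and> 0 < ?n"
      using n pow[of ?n] assms(2) by (simp add: hd_conv_nth)
  next
    fix m assume m: "(p ^^ m) (hd xs) = hd xs \<and> 0 < m"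
    show "?n \<le> m"
    proof (rule ccontr)
      assume "\<not> ?n \<le> m"
      then have "m < ?n" by simp
      then have "xs ! m = xs ! 0" using m pow[of m] assms(2) by (simp add: hd_conv_nth)
      then show False
        using m \<open>m < ?n\<close> n nth_eq_iff_index_eq[OF assms(1)] by blast
    qed
  qed
  then show ?thesis
    by (intro nth_equalityI) (auto simp: pow)
qed

text \<open>The converse of \<open>support_eqI\<close>: these four properties together characterise
  \<open>support p x\<close>. The last entry is sent back to the first because
  \<open>p ^^ least_power p x\<close> fixes \<open>x\<close>.\<close>

lemma
  assumes "permutation p"
  shows distinct_support: "distinct (support p x)"
    and support_nonempty: "support p x \<noteq> []"
    and hd_support: "hd (support p x) = x"
    and map_support: "map p (support p x) = rotate1 (support p x)"
proof -
  show "distinct (support p x)" by (rule cycle_of_permutation[OF assms])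
  have pos: "least_power p x > 0" using least_power_of_permutation(2)[OF assms] .
  then show "support p x \<noteq> []" by simp
  show "hd (support p x) = x" using pos by (simp add: hd_map)
  show "map p (support p x) = rotate1 (support p x)"
  proof (rule nth_equalityI)
    fix i assume "i < length (map p (support p x))"
    then have i: "i < least_power p x" by simp
    have "rotate1 (support p x) ! i = support p x ! (Suc i mod least_power p x)"
      using i nth_rotate1[of i "support p x"] by simp
    also have "\<dots> = (p ^^ (Suc i mod least_power p x)) x" using pos by simp
    also have "\<dots> = (p ^^ Suc i) x"
    proof (cases "Suc i = least_power p x")
      case True
      then show ?thesis using least_power_of_permutation(1)[OF assms, of x] by simp
    next
      case False
      then have "Suc i < least_power p x" using i by simp
      then show ?thesis by simp
    qed
    finally show "map p (support p x) ! i = rotate1 (support p x) ! i" using i by simp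
  qed simp
qed

text \<open>Powers of \<open>p\<close> are injective and fix \<open>a\<close>, so an orbit that
  reaches \<open>a\<close> must have started there.\<close>

lemma fixpoint_notin_support:
  assumes "permutation p" "p a = a" "x \<noteq> a"
  shows "a \<notin> set (support p x)"
proof
  assume "a \<in> set (support p x)"
  then obtain i where i: "(p ^^ i) x = a" by auto
  have "(p ^^ i) a = a" using assms(2) by (induction i) auto
  moreover have "inj (p ^^ i)" using assms(1) by (simp add: permutation_bijective bij_is_inj inj_fn)
  ultimately have "x = a" using i by (metis injD)
  then show False using assms(3) by simp
qed

section \<open>Inserting a new largest letter into the cycle form\<close>

text \<open>The effect on a cycle of composing with a transposition that involves a fixed point
  \<open>a\<close>. Lists without \<open>c\<close> stay unchanged, so the function can be mapped
  over all cycles at once.\<close>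

primrec insert_after :: "'a \<Rightarrow> 'a \<Rightarrow> 'a list \<Rightarrow> 'a list" where
  "insert_after c a [] = []"
| "insert_after c a (x # xs) = x # (if x = c then a # xs else insert_after c a xs)"

lemma insert_after_notin [simp]: "c \<notin> set xs \<Longrightarrow> insert_after c a xs = xs"
  by (induction xs) auto

lemma insert_after_append:
  "insert_after c a (xs @ ys) =
     (if c \<in> set xs then insert_after c a xs @ ys else xs @ insert_after c a ys)"
  by (induction xs) auto

lemma insert_after_concat:
  "distinct (concat xss) \<Longrightarrow> insert_after c a (concat xss) = concat (map (insert_after c a) xss)"
proof (induction xss)
  case (Cons xs xss)
  show ?case
  proof (cases "c \<in> set xs")
    case True
    then have "c \<notin> set ys" if "ys \<in> set xss" for ys
      using Cons.prems that by auto
    then have "map (insert_after c a) xss = xss"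
      by (intro map_idI) simp
    then show ?thesis using True by (simp add: insert_after_append)
  next
    case False
    then show ?thesis using Cons by (simp add: insert_after_append)
  qed
qed simp

lemma set_insert_after: "set (insert_after c a xs) = (if c \<in> set xs then insert a (set xs) else set xs)"
  by (induction xs) auto

lemma distinct_insert_after:
  "distinct xs \<Longrightarrow> a \<notin> set xs \<Longrightarrow> distinct (insert_after c a xs)"
  by (induction xs) (auto simp: set_insert_after)

lemma insert_after_nth:
  "distinct xs \<Longrightarrow> i < length xs \<Longrightarrow>
     insert_after (xs ! i) a xs = take (Suc i) xs @ a # drop (Suc i) xs"
proof (induction xs arbitrary: i)
  case (Cons x xs)
  then show ?case by (cases i) (auto simp: nth_mem)
qed simp

text \<open>The composite sends \<open>c\<close> to \<open>M\<close> and \<open>M\<close> to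
  \<open>p c\<close>, and agrees with \<open>p\<close> elsewhere. Hence \<open>M\<close> is spliced
  in directly after \<open>c\<close>, and cycles avoiding \<open>c\<close> and \<open>M\<close> are
  untouched.\<close>

lemma support_comp_transpose:
  assumes p: "permutation p" and M: "p M = M" and c: "c \<noteq> M" and x: "x \<noteq> M"
  shows "support (p \<circ> transpose M c) x = insert_after c M (support p x)"
proof -
  let ?p = "p \<circ> transpose M c"
  obtain zs where zs: "support p x = zs" by blast
  have z: "distinct zs" "zs \<noteq> []" "hd zs = x" "map p zs = rotate1 zs"
    using distinct_support[OF p, of x] support_nonempty[OF p, of x] hd_support[OF p, of x]
      map_support[OF p, of x] unfolding zs by blast+
  have notM: "M \<notin> set zs"
    using fixpoint_notin_support[OF p M x] unfolding zs .
  show ?thesis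
    unfolding zs
  proof (cases "c \<in> set zs")
    case False
    have "map ?p zs = map p zs"
      using False notM by (intro map_cong) (auto simp: transpose_def)
    then have "support ?p (hd zs) = zs" using z by (intro support_eqI) simp_all
    then show "support ?p x = insert_after c M zs" using False z(3) by (simp del: map_eq_conv)
  next
    case True
    obtain as bs where eq: "zs = as @ c # bs" using split_list[OF True] by blast
    have c_as: "c \<notin> set as" "c \<notin> set bs" "M \<notin> set as" "M \<notin> set bs" using z(1) notM eq by auto
    have ins: "insert_after c M zs = as @ c # M # bs"
      using eq c_as by (simp add: insert_after_append)
    have m: "map ?p (as @ c # M # bs) = map p as @ M # p c # map p bs"
      using c_as M by (auto simp: transpose_def)
    have rot: "map ?p (as @ c # M # bs) = rotate1 (as @ c # M # bs)"
    proof (cases as)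
      case Nil
      then show ?thesis using m z(4) eq by (simp del: map_eq_conv)
    next
      case (Cons y ys)
      \<comment> \<open>Rotation moves the head \<open>y\<close> to the end. Cutting both sides
        after \<open>length as\<close> entries separates the parts before and after the place of
        insertion.\<close>
      have "map p as @ p c # map p bs = (ys @ [c]) @ bs @ [y]"
        using z(4) eq Cons by simp
      then have "map p as = ys @ [c]" "p c # map p bs = bs @ [y]"
        using Cons by (subst (asm) append_eq_append_conv; simp)+
      then show ?thesis using m Cons by (simp del: map_eq_conv)
    qed
    have "support ?p (hd (as @ c # M # bs)) = as @ c # M # bs"
      using z(1) notM eq rot by (intro support_eqI) auto
    moreover have "hd (as @ c # M # bs) = x" using z(3) eq by (cases as) auto
    ultimately show "support ?p x = insert_after c M zs" using ins by (simp only:)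
  qed
qed

text \<open>Started at \<open>M\<close>, the new cycle runs through the old cycle of
  \<open>c\<close> and ends in \<open>c\<close>. For \<open>c\<close> smaller than \<open>M\<close>
  this shows that \<open>M\<close> does not open a cycle in standard form.\<close>

lemma mem_support_comp_transpose:
  assumes p: "permutation p" and M: "p M = M" and c: "c \<noteq> M"
  shows "c \<in> set (support (p \<circ> transpose M c) M)"
proof -
  obtain zs where zs: "support p c = c # zs"
    using support_nonempty[OF p, of c] hd_support[OF p, of c] by (cases "support p c") auto
  have d: "distinct (c # zs)" and r: "p c # map p zs = zs @ [c]"
    using distinct_support[OF p, of c] map_support[OF p, of c] unfolding zs by simp_all
  have notM: "M \<notin> set zs"
    using fixpoint_notin_support[OF p M c] unfolding zs by simp
  have "map (p \<circ> transpose M c) zs = map p zs"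
    using d notM by (intro map_cong) (auto simp: transpose_def)
  then have "map (p \<circ> transpose M c) (M # zs @ [c]) = rotate1 (M # zs @ [c])"
    using r M by (simp del: map_eq_conv)
  then have "support (p \<circ> transpose M c) (hd (M # zs @ [c])) = M # zs @ [c]"
    using d notM c by (intro support_eqI) auto
  then show ?thesis by simp
qed

lemma standard_cycle_form_Suc_fixed:
  assumes "p permutes {1..n}"
  shows "standard_cycle_form (Suc n) p = standard_cycle_form n p @ [[Suc n]]"
proof -
  have "p (Suc n) = Suc n" using assms by (simp add: permutes_def)
  then have "support p (hd [Suc n]) = [Suc n]" by (intro support_eqI) auto
  then have sup: "support p (Suc n) = [Suc n]" by simp
  then have "\<forall>y\<in>set (support p (Suc n)). Suc n \<le> y" unfolding sup by simp
  then have "filter (\<lambda>x. \<forall>y\<in>set (support p x). x \<le> y) [1..<Suc (Suc n)] =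
      filter (\<lambda>x. \<forall>y\<in>set (support p x). x \<le> y) [1..<Suc n] @ [Suc n]"
    by simp
  then show ?thesis using sup by (simp only: standard_cycle_form_def map_append list.map)
qed

lemma flatten_Suc_fixed:
  "p permutes {1..n} \<Longrightarrow> flatten (Suc n) p = flatten n p @ [Suc n]"
  by (simp add: flatten_def standard_cycle_form_Suc_fixed)

text \<open>As the new letter exceeds all others, the cycle minima are the same as before. So the
  cycles keep their order and starting points, and the insertion in one cycle is an insertion in the
  flattened word.\<close>

lemma flatten_Suc_comp_transpose:
  assumes "p permutes {1..n}" and c: "c \<in> {1..n}" and d: "distinct (flatten n p)"
  shows "flatten (Suc n) (p \<circ> transpose (Suc n) c) = insert_after c (Suc n) (flatten n p)"
proof -
  let ?M = "Suc n" and ?p = "p \<circ> transpose (Suc n) c"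
  let ?min = "\<lambda>p x. \<forall>y\<in>set (support p x). x \<le> y"
  have p: "permutation p" using assms(1) permutation_permutes by blast
  have M: "p ?M = ?M" using assms(1) by (simp add: permutes_def)
  have cM: "c \<noteq> ?M" using c by simp
  have "\<not> ?min ?p ?M"
    using mem_support_comp_transpose[of p ?M c, OF p M cM] c by force
  then have "filter (?min ?p) [1..<Suc ?M] = filter (?min ?p) [1..<Suc n]"
    by simp
  also have "\<dots> = filter (?min p) [1..<Suc n]"
  proof (rule filter_cong)
    fix x assume x: "x \<in> set [1..<Suc n]"
    then have "support ?p x = insert_after c ?M (support p x)"
      by (intro support_comp_transpose[OF p M cM]) auto
    then show "?min ?p x = ?min p x"
      using x by (simp only: set_insert_after) auto
  qed simp
  finally have "standard_cycle_form ?M ?p = map (support ?p) (filter (?min p) [1..<Suc n])"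
    by (simp only: standard_cycle_form_def)
  also have "\<dots> = map (insert_after c ?M) (standard_cycle_form n p)"
    unfolding standard_cycle_form_def map_map
  proof (rule map_cong)
    fix x assume "x \<in> set (filter (?min p) [1..<Suc n])"
    then show "support ?p x = (insert_after c ?M \<circ> support p) x"
      using support_comp_transpose[OF p M cM, of x] by (simp only: o_def) auto
  qed simp
  finally show ?thesis
    using insert_after_concat[OF d[unfolded flatten_def]] by (simp add: flatten_def)
qed

text \<open>\<open>sum_over_permutations_insert\<close> puts the transposition on the left. Summing
  over inverses before and after moves it to the right, where it means insertion after
  \<open>c\<close>; \<open>c = Suc n\<close> gives a new fixed point.\<close>

lemma sum_permutes_Suc:
  "(\<Sum>p | p permutes {1..Suc n}. f p) =
     (\<Sum>p | p permutes {1..n}. \<Sum>c\<in>{1..Suc n}. f (p \<circ> transpose (Suc n) c))"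
proof -
  have ins: "{1..Suc n} = insert (Suc n) {1..n}" by auto
  have "(\<Sum>p | p permutes {1..Suc n}. f p) = (\<Sum>p | p permutes {1..Suc n}. f (inv p))"
    by (rule sum_permutations_inverse)
  also have "\<dots> = (\<Sum>c\<in>{1..Suc n}. \<Sum>p | p permutes {1..n}. f (inv (transpose (Suc n) c \<circ> p)))"
    unfolding ins by (rule sum_over_permutations_insert) auto
  also have "\<dots> = (\<Sum>c\<in>{1..Suc n}. \<Sum>p | p permutes {1..n}. f (inv p \<circ> transpose (Suc n) c))"
    by (intro sum.cong refl arg_cong[of _ _ f])
       (simp add: o_inv_distrib permutes_bij bij_swap)
  also have "\<dots> = (\<Sum>c\<in>{1..Suc n}. \<Sum>p | p permutes {1..n}. f (p \<circ> transpose (Suc n) c))"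
    by (intro sum.cong refl sum_permutations_inverse[symmetric])
  finally show ?thesis by (subst sum.swap)
qed

lemma permutes_Suc_decompose:
  assumes "p permutes {1..Suc n}"
  obtains q c where "q permutes {1..n}" "c \<in> {1..Suc n}" "p = q \<circ> transpose (Suc n) c"
proof -
  have ins: "{1..Suc n} = insert (Suc n) {1..n}" by auto
  have "inv p \<in> {p. p permutes insert (Suc n) {1..n}}"
    using assms ins by (simp add: permutes_inv)
  then obtain bq where bq: "bq \<in> {(b, p). b \<in> insert (Suc n) {1..n} \<and> p \<in> {p. p permutes {1..n}}}"
    "inv p = (\<lambda>(b, p). transpose (Suc n) b \<circ> p) bq"
    unfolding permutes_insert by blast
  obtain c q where "bq = (c, q)" by (cases bq)
  then have cq: "inv p = transpose (Suc n) c \<circ> q" "c \<in> {1..Suc n}" "q permutes {1..n}"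
    using bq unfolding ins by simp_all
  have "p = inv (inv p)" using assms by (simp add: permutes_bij inv_inv_eq)
  also have "\<dots> = inv q \<circ> transpose (Suc n) c"
    unfolding cq(1) using cq(3) by (simp add: o_inv_distrib permutes_bij bij_swap)
  finally show ?thesis using that cq permutes_inv by blast
qed

lemma flatten_in_permutations_of_set:
  "p permutes {1..n} \<Longrightarrow> flatten n p \<in> permutations_of_set {1..n}"
proof (induction n arbitrary: p)
  case 0
  then show ?case by (simp add: flatten_def standard_cycle_form_def)
next
  case (Suc n)
  obtain q c where q: "q permutes {1..n}" "c \<in> {1..Suc n}" "p = q \<circ> transpose (Suc n) c"
    using permutes_Suc_decompose[OF Suc.prems] .
  have IH: "set (flatten n q) = {1..n}" "distinct (flatten n q)"
    using Suc.IH[OF q(1)] by (auto simp: permutations_of_set_def)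
  show ?case
  proof (cases "c = Suc n")
    case True
    then show ?thesis
      using IH flatten_Suc_fixed[OF q(1)] q(3) by (auto simp: permutations_of_set_def)
  next
    case False
    then have c: "c \<in> {1..n}" using q(2) by auto
    have "flatten (Suc n) p = insert_after c (Suc n) (flatten n q)"
      unfolding q(3) by (rule flatten_Suc_comp_transpose[OF q(1) c IH(2)])
    then show ?thesis
      using IH c distinct_insert_after[of "flatten n q" "Suc n" c]
      by (auto simp: permutations_of_set_def set_insert_after)
  qed
qed

text \<open>The new letter either forms a cycle of its own, which comes last, or follows one of the
  \<open>n\<close> old letters. For \<open>n > 0\<close> the word ending in \<open>Suc n\<close>
  thus occurs twice, the second time for \<open>i = n - 1\<close>.\<close>

lemma sum_flatten_Suc:
  "(\<Sum>p | p permutes {1..Suc n}. f (flatten (Suc n) p)) =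
     (\<Sum>p | p permutes {1..n}. f (flatten n p @ [Suc n]) +
        (\<Sum>i<n. f (take (Suc i) (flatten n p) @ Suc n # drop (Suc i) (flatten n p))))"
  unfolding sum_permutes_Suc[of "\<lambda>p. f (flatten (Suc n) p)"]
proof (rule sum.cong)
  fix p assume "p \<in> {p. p permutes {1..n}}"
  then have p: "p permutes {1..n}" by simp
  let ?w = "flatten n p"
  have w: "set ?w = {1..n}" "distinct ?w"
    using flatten_in_permutations_of_set[OF p] by (auto simp: permutations_of_set_def)
  have len: "length ?w = n" using w distinct_card[of ?w] by simp
  have "(\<Sum>c\<in>{1..Suc n}. f (flatten (Suc n) (p \<circ> transpose (Suc n) c))) =
      f (flatten (Suc n) p) + (\<Sum>c\<in>{1..n}. f (flatten (Suc n) (p \<circ> transpose (Suc n) c)))"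
    by (simp add: add.commute)
  also have "(\<Sum>c\<in>{1..n}. f (flatten (Suc n) (p \<circ> transpose (Suc n) c))) =
      (\<Sum>c\<in>{1..n}. f (insert_after c (Suc n) ?w))"
    by (intro sum.cong refl arg_cong[of _ _ f] flatten_Suc_comp_transpose p w)
  \<comment> \<open>The letter \<open>c\<close> is replaced by its position in the word.\<close>
  also have "\<dots> = (\<Sum>i<n. f (insert_after (?w ! i) (Suc n) ?w))"
  proof (rule sum.reindex_bij_betw[symmetric])
    show "bij_betw ((!) ?w) {..<n} {1..n}"
      using bij_betw_nth[OF w(2), of "{..<n}" "{1..n}"] w(1) len by simp
  qed
  also have "\<dots> = (\<Sum>i<n. f (take (Suc i) ?w @ Suc n # drop (Suc i) ?w))"
    by (intro sum.cong refl arg_cong[of _ _ f] insert_after_nth w) (simp add: len)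
  finally show "(\<Sum>c\<in>{1..Suc n}. f (flatten (Suc n) (p \<circ> transpose (Suc n) c))) =
      f (?w @ [Suc n]) + (\<Sum>i<n. f (take (Suc i) ?w @ Suc n # drop (Suc i) ?w))"
    by (simp only: flatten_Suc_fixed[OF p])
qed simp

section \<open>Right-to-left minima\<close>

primrec rl_minima :: "'a::linorder list \<Rightarrow> nat" where
  "rl_minima [] = 0"
| "rl_minima (x # xs) = (if \<forall>y\<in>set xs. x < y then 1 else 0) + rl_minima xs"

lemma rl_minima_snoc_max:
  "\<forall>y\<in>set xs. y < a \<Longrightarrow> rl_minima (xs @ [a]) = Suc (rl_minima xs)"
  by (induction xs) auto

text \<open>With a smaller letter to its right, the maximum is no right-to-left minimum, and it
  never spoils that property for a letter before it.\<close>

lemma rl_minima_insert_max: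
  "ys \<noteq> [] \<Longrightarrow> \<forall>y\<in>set (xs @ ys). y < a \<Longrightarrow> rl_minima (xs @ a # ys) = rl_minima (xs @ ys)"
  by (induction xs) (auto simp: neq_Nil_conv not_less_iff_gr_or_eq)

text \<open>Every letter of \<open>xs\<close> has the smaller \<open>m\<close> to its right. This is
  why the left factor will be counted without weight.\<close>

lemma rl_minima_split_min:
  "\<forall>y\<in>set xs. m < y \<Longrightarrow> \<forall>y\<in>set ys. m < y \<Longrightarrow> rl_minima (xs @ m # ys) = Suc (rl_minima ys)"
  by (induction xs) auto

lemma sum_permutations_of_set_insert_max:
  fixes f :: "'a::linorder list \<Rightarrow> 'b::comm_monoid_add"
  assumes "finite A" "a \<notin> A"
  shows "(\<Sum>w\<in>permutations_of_set (insert a A). f w) =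
     (\<Sum>u\<in>permutations_of_set A. \<Sum>i\<le>card A. f (take i u @ a # drop i u))"
proof -
  have len: "length u = card A" if "u \<in> permutations_of_set A" for u
    using that by (rule length_finite_permutations_of_set)
  have "(\<Sum>u\<in>permutations_of_set A. \<Sum>i\<le>card A. f (take i u @ a # drop i u)) =
      (\<Sum>(u, i)\<in>permutations_of_set A \<times> {..card A}. f (take i u @ a # drop i u))"
    by (rule sum.cartesian_product)
  also have "\<dots> = (\<Sum>w\<in>permutations_of_set (insert a A). f w)"
  \<comment> \<open>The inverse map deletes \<open>a\<close> and records how many letters precede
    it.\<close>
  proof (rule sum.reindex_bij_witness[where
        i = "\<lambda>w. (filter (\<lambda>x. x \<noteq> a) w, length (takeWhile (\<lambda>x. x \<noteq> a) w))" and
        j = "\<lambda>(u, i). take i u @ a # drop i u"], goal_cases)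
    case (1 ui)
    then obtain u i where ui: "ui = (u, i)" "u \<in> permutations_of_set A" "i \<le> card A" by auto
    have a: "a \<notin> set u" using ui assms by (simp add: permutations_of_set_def)
    have "filter (\<lambda>x. x \<noteq> a) u = u" using a by (simp add: filter_id_conv) metis
    moreover have "filter (\<lambda>x. x \<noteq> a) (take i u) @ filter (\<lambda>x. x \<noteq> a) (drop i u) = filter (\<lambda>x. x \<noteq> a) u"
      by (metis append_take_drop_id filter_append)
    moreover have "takeWhile (\<lambda>x. x \<noteq> a) (take i u @ a # drop i u) = take i u"
      using a by (subst takeWhile_append2) (auto dest: in_set_takeD)
    ultimately show ?case using ui len[of u] by simp
  next
    case (2 ui)
    then obtain u i where ui: "ui = (u, i)" "u \<in> permutations_of_set A" "i \<le> card A" by auto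
    have u: "set u = A" "distinct u" using ui by (auto simp: permutations_of_set_def)
    have "set (take i u) \<union> set (drop i u) = A"
      by (metis append_take_drop_id set_append u(1))
    moreover have "set (take i u) \<inter> set (drop i u) = {}"
      using u(2) by (simp add: set_take_disj_set_drop_if_distinct)
    ultimately have "set (take i u @ a # drop i u) = insert a A" "distinct (take i u @ a # drop i u)"
      using u assms(2) by (auto dest: in_set_takeD in_set_dropD)
    then show ?case using ui(1) by (simp add: permutations_of_set_def)
  next
    case (3 w)
    then have w: "set w = insert a A" "distinct w" by (auto simp: permutations_of_set_def)
    then obtain xs ys where eq: "w = xs @ a # ys" "a \<notin> set xs" "a \<notin> set ys"
      by (metis distinct.simps(2) distinct_append insertI1 not_distinct_conv_prefix split_list_first)
    have "filter (\<lambda>x. x \<noteq> a) xs = xs" "filter (\<lambda>x. x \<noteq> a) ys = ys"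
      using eq by (simp_all add: filter_id_conv) metis+
    moreover have "takeWhile (\<lambda>x. x \<noteq> a) w = xs" using eq by (auto simp: takeWhile_append)
    ultimately show ?case using eq by simp
  next
    case (4 w)
    then have w: "set w = insert a A" "distinct w" by (auto simp: permutations_of_set_def)
    then obtain xs ys where eq: "w = xs @ a # ys" "a \<notin> set xs" "a \<notin> set ys"
      by (metis distinct.simps(2) distinct_append insertI1 not_distinct_conv_prefix split_list_first)
    have f: "filter (\<lambda>x. x \<noteq> a) xs = xs" "filter (\<lambda>x. x \<noteq> a) ys = ys"
      using eq by (simp_all add: filter_id_conv) metis+
    have t: "takeWhile (\<lambda>x. x \<noteq> a) w = xs" using eq by (auto simp: takeWhile_append)
    have "set (xs @ ys) = A" "distinct (xs @ ys)" using w eq assms(2) by auto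
    moreover then have "length (xs @ ys) = card A" by (metis distinct_card)
    ultimately show ?case using f t eq(1) by (auto simp: permutations_of_set_def)
  next
    case (5 ui)
    then show ?case by auto
  qed
  finally show ?thesis by simp
qed

text \<open>
  Cutting a word \<open>1 # u\<close> into cycles in standard form means choosing a subset of the right-to-left
  minima of \<open>u\<close> as the starting points of the further cycles.
\<close>

lemma sum_flatten_eq:
  fixes f :: "nat list \<Rightarrow> 'a::comm_semiring_1"
  shows "(\<Sum>p | p permutes {1..Suc n}. f (flatten (Suc n) p)) =
     (\<Sum>u\<in>permutations_of_set {2..Suc n}. 2 ^ rl_minima u * f (1 # u))"
proof (induction n arbitrary: f)
  case 0
  have "flatten (Suc 0) id = [1]"
    using flatten_Suc_fixed[of id 0] by (simp add: flatten_def standard_cycle_form_def)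
  then show ?case by (simp add: id_def)
next
  case (Suc n)
  let ?M = "Suc (Suc n)"
  let ?P = "permutations_of_set {2..Suc n}"
  let ?i = "\<lambda>i w. take i w @ ?M # drop i w"
  \<comment> \<open>The induction hypothesis is applied to the function that sums \<open>f\<close>
    over all insertions of \<open>?M\<close>, hence the induction with arbitrary
    \<open>f\<close>.\<close>
  have "(\<Sum>p | p permutes {1..Suc (Suc n)}. f (flatten (Suc (Suc n)) p)) =
     (\<Sum>u\<in>?P. 2 ^ rl_minima u * (f ((1 # u) @ [?M]) + (\<Sum>i<Suc n. f (?i (Suc i) (1 # u)))))"
    by (simp only: sum_flatten_Suc[of f "Suc n"]
          Suc[of "\<lambda>w. f (w @ [?M]) + (\<Sum>i<Suc n. f (?i (Suc i) w))"])
  also have "\<dots> = (\<Sum>u\<in>?P. \<Sum>i\<le>n. 2 ^ rl_minima (?i i u) * f (1 # ?i i u))"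
  proof (rule sum.cong)
    fix u assume u: "u \<in> ?P"
    have len: "length u = n" using length_finite_permutations_of_set[OF u] by simp
    have lt: "\<forall>y\<in>set u. y < ?M" using u by (auto simp: permutations_of_set_def)
    have rn: "rl_minima (u @ [?M]) = Suc (rl_minima u)" using lt by (rule rl_minima_snoc_max)
    have ri: "rl_minima (?i i u) = rl_minima u" if "i < n" for i
      using rl_minima_insert_max[of "drop i u" "take i u" ?M] that len lt by simp
    \<comment> \<open>The word ending in \<open>?M\<close> arises twice; this factor
      \<open>2\<close> pays for its additional right-to-left minimum.\<close>
    have "2 ^ rl_minima u * (f ((1 # u) @ [?M]) + (\<Sum>i<Suc n. f (?i (Suc i) (1 # u)))) =
        2 ^ rl_minima u * (2 * f (1 # u @ [?M]) + (\<Sum>i<n. f (1 # ?i i u)))"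
      using len by (simp add: algebra_simps mult_2)
    also have "\<dots> = 2 ^ rl_minima (u @ [?M]) * f (1 # u @ [?M])
        + (\<Sum>i<n. 2 ^ rl_minima (?i i u) * f (1 # ?i i u))"
      using rn by (simp add: ri sum_distrib_left distrib_left mult_ac)
    also have "\<dots> = (\<Sum>i\<le>n. 2 ^ rl_minima (?i i u) * f (1 # ?i i u))"
      using len by (simp add: lessThan_Suc_atMost[symmetric] add.commute)
    finally show "2 ^ rl_minima u * (f ((1 # u) @ [?M]) + (\<Sum>i<Suc n. f (?i (Suc i) (1 # u)))) =
        (\<Sum>i\<le>n. 2 ^ rl_minima (?i i u) * f (1 # ?i i u))" .
  qed simp
  also have "\<dots> = (\<Sum>w\<in>permutations_of_set (insert ?M {2..Suc n}). 2 ^ rl_minima w * f (1 # w))"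
    by (subst sum_permutations_of_set_insert_max) auto
  also have "insert ?M {2..Suc n} = {2..?M}" by auto
  finally show ?case .
qed

subsection \<open>Valleys and exponential generating functions\<close>

lemma valleys_short [simp]: "valleys [] = 0" "valleys [x] = 0" "valleys [x, y] = 0"
  by (simp_all add: valleys_def)

text \<open>Position \<open>0\<close> is tested separately, and the remaining positions are those of
  the tail shifted by one.\<close>

lemma valleys_Cons3 [simp]:
  "valleys (x # y # z # w) = (if y \<le> x \<and> y \<le> z then 1 else 0) + valleys (y # z # w)"
proof -
  let ?V = "\<lambda>w. {i. i + 2 < length w \<and> w ! (i + 1) = Min {w ! i, w ! (i + 1), w ! (i + 2)}}"
  have fin: "finite (?V v)" for v :: "'a list"
    by (rule finite_subset[of _ "{..<length v}"]) auto
  have min: "y = Min {x, y, z} \<longleftrightarrow> y \<le> x \<and> y \<le> z"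
    by (auto simp: min_def)
  have mem: "i \<in> ?V (x # y # z # w) \<longleftrightarrow>
      i \<in> (if y \<le> x \<and> y \<le> z then {0} else {}) \<union> Suc ` ?V (y # z # w)" for i
  proof (cases i)
    case 0
    then show ?thesis using min by (auto simp del: Min_insert)
  next
    case (Suc j)
    then show ?thesis by (auto simp: image_iff)
  qed
  then have "?V (x # y # z # w) = (if y \<le> x \<and> y \<le> z then {0} else {}) \<union> Suc ` ?V (y # z # w)"
    by blast
  then have "valleys (x # y # z # w) =
      card ((if y \<le> x \<and> y \<le> z then {0} else {}) \<union> Suc ` ?V (y # z # w))"
    by (simp only: valleys_def)
  also have "\<dots> = card (if y \<le> x \<and> y \<le> z then {0::nat} else {}) + card (Suc ` ?V (y # z # w))"
    by (rule card_Un_disjoint) (use fin in auto)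
  also have "card (Suc ` ?V (y # z # w)) = valleys (y # z # w)"
    by (simp only: valleys_def card_image[OF inj_Suc])
  finally show ?thesis by simp
qed

lemma valleys_Cons_min: "\<forall>y\<in>set xs. m < y \<Longrightarrow> valleys (m # xs) = valleys xs"
proof (cases xs)
  case (Cons y ys)
  then show "\<forall>y\<in>set xs. m < y \<Longrightarrow> ?thesis" by (cases ys) auto
qed simp

text \<open>The letter \<open>m\<close> is a valley exactly when it has neighbours on both sides.
  Those neighbours are not valleys, neither next to \<open>m\<close> nor as end letters of
  \<open>xs\<close> and \<open>ys\<close>.\<close>

lemma valleys_split_min:
  "\<forall>y\<in>set xs. m < y \<Longrightarrow> \<forall>y\<in>set ys. m < y \<Longrightarrow>
     valleys (xs @ m # ys) = valleys xs + valleys ys + (if xs = [] \<or> ys = [] then 0 else 1)"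
proof (induction xs)
  case Nil
  then show ?case by (simp add: valleys_Cons_min)
next
  case (Cons x xs)
  show ?case
  proof (cases xs)
    case Nil
    then show ?thesis using Cons.prems valleys_Cons_min[of ys m] by (cases ys) auto
  next
    case (Cons x' xs')
    then show ?thesis using Cons.IH Cons.prems by (cases xs') auto
  qed
qed

section \<open>Splitting words at the smallest letter\<close>

lemma sum_permutations_of_set_split:
  assumes "finite A" "m \<notin> A"
  shows "(\<Sum>w\<in>permutations_of_set (insert m A). f w) =
     (\<Sum>T\<in>Pow A. \<Sum>xs\<in>permutations_of_set T. \<Sum>ys\<in>permutations_of_set (A - T). f (xs @ m # ys))"
proof -
  let ?S = "SIGMA T : Pow A. permutations_of_set T \<times> permutations_of_set (A - T)"
  have "(\<Sum>T\<in>Pow A. \<Sum>xs\<in>permutations_of_set T. \<Sum>ys\<in>permutations_of_set (A - T). f (xs @ m # ys))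
      = (\<Sum>(T, xs, ys)\<in>?S. f (xs @ m # ys))"
    using assms(1) by (simp add: sum.cartesian_product sum.Sigma case_prod_unfold)
  also have "\<dots> = (\<Sum>w\<in>permutations_of_set (insert m A). f w)"
  \<comment> \<open>The inverse map cuts the word at \<open>m\<close>; the set \<open>T\<close>
    consists of the letters to its left.\<close>
  proof (rule sum.reindex_bij_witness[where
        i = "\<lambda>w. (set (takeWhile (\<lambda>x. x \<noteq> m) w), takeWhile (\<lambda>x. x \<noteq> m) w,
                  tl (dropWhile (\<lambda>x. x \<noteq> m) w))" and
        j = "\<lambda>(T, xs, ys). xs @ m # ys"], goal_cases)
    case (1 p)
    then obtain T xs ys where p: "p = (T, xs, ys)" "T \<subseteq> A" "set xs = T" "set ys = A - T"
      by (auto simp: permutations_of_set_def)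
    then have "m \<notin> set xs" using assms(2) by auto
    then have "takeWhile (\<lambda>x. x \<noteq> m) (xs @ m # ys) = xs" "dropWhile (\<lambda>x. x \<noteq> m) (xs @ m # ys) = m # ys"
      by (auto simp: takeWhile_append dropWhile_append)
    then show ?case using p by simp
  next
    case (2 p)
    then show ?case using assms by (auto simp: permutations_of_set_def)
  next
    case (3 w)
    then have "m \<in> set w" by (simp add: permutations_of_set_def)
    then have "dropWhile (\<lambda>x. x \<noteq> m) w = m # tl (dropWhile (\<lambda>x. x \<noteq> m) w)"
      by (metis (mono_tags, lifting) dropWhile_eq_Nil_conv hd_dropWhile list.collapse)
    then show ?case by (metis (no_types, lifting) case_prod_conv takeWhile_dropWhile_id)
  next
    case (4 w)
    then have w: "set w = insert m A" "distinct w" by (auto simp: permutations_of_set_def)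
    then obtain xs ys where eq: "w = xs @ m # ys" "m \<notin> set xs" "m \<notin> set ys"
      by (metis distinct.simps(2) distinct_append insertI1 not_distinct_conv_prefix split_list_first)
    then have "takeWhile (\<lambda>x. x \<noteq> m) w = xs" "dropWhile (\<lambda>x. x \<noteq> m) w = m # ys"
      by (auto simp: takeWhile_append dropWhile_append)
    moreover have "set xs \<subseteq> A" "distinct xs" "set ys = A - set xs" "distinct ys"
      using w eq assms(2) by auto
    ultimately show ?case by (auto simp: permutations_of_set_def)
  next
    case (5 p)
    then show ?case by auto
  qed
  finally show ?thesis by simp
qed

lemma sum_Pow_card:
  fixes f :: "nat \<Rightarrow> 'a::comm_semiring_1"
  assumes "finite A"
  shows "(\<Sum>T\<in>Pow A. f (card T)) = (\<Sum>k\<le>card A. of_nat (card A choose k) * f k)"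
proof -
  have "(\<Sum>T\<in>Pow A. f (card T)) = (\<Sum>k\<le>card A. \<Sum>T\<in>{T\<in>Pow A. card T = k}. f (card T))"
    using assms by (intro sum.group[symmetric]) (auto intro: card_mono)
  also have "\<dots> = (\<Sum>k\<le>card A. of_nat (card A choose k) * f k)"
  proof (rule sum.cong)
    fix k
    have "(\<Sum>T\<in>{T\<in>Pow A. card T = k}. f (card T)) = (\<Sum>T\<in>{T. T \<subseteq> A \<and> card T = k}. f k)"
      by (rule sum.cong) auto
    then show "(\<Sum>T\<in>{T\<in>Pow A. card T = k}. f (card T)) = of_nat (card A choose k) * f k"
      using n_subsets[OF assms, of k] by simp
  qed simp
  finally show ?thesis .
qed

text \<open>The value \<open>t = 2\<close> belongs to flattened permutations, and
  \<open>t = 1\<close> to the left factors that appear in the recursion.\<close>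

definition word_sum :: "'a::comm_semiring_1 \<Rightarrow> 'a \<Rightarrow> nat set \<Rightarrow> 'a" where
  "word_sum t q A = (\<Sum>u\<in>permutations_of_set A. t ^ rl_minima u * q ^ valleys u)"

lemma word_sum_empty [simp]: "word_sum t q {} = 1"
  by (simp add: word_sum_def)

lemma word_sum_insert_min:
  assumes "finite A" "\<forall>a\<in>A. m < a"
  shows "word_sum t q (insert m A) =
     t * (\<Sum>T\<in>Pow A. (if T = {} \<or> T = A then 1 else q) * (word_sum 1 q T * word_sum t q (A - T)))"
proof -
  have "m \<notin> A" using assms(2) by auto
  then have "word_sum t q (insert m A) = (\<Sum>T\<in>Pow A. \<Sum>xs\<in>permutations_of_set T.
      \<Sum>ys\<in>permutations_of_set (A - T). t ^ rl_minima (xs @ m # ys) * q ^ valleys (xs @ m # ys))"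
    unfolding word_sum_def by (intro sum_permutations_of_set_split assms(1))
  also have "\<dots> = (\<Sum>T\<in>Pow A. \<Sum>xs\<in>permutations_of_set T. \<Sum>ys\<in>permutations_of_set (A - T).
      t * (if T = {} \<or> T = A then 1 else q) * ((1 ^ rl_minima xs * q ^ valleys xs) *
        (t ^ rl_minima ys * q ^ valleys ys)))"
  proof (intro sum.cong refl)
    fix T xs ys
    assume T: "T \<in> Pow A" and xs: "xs \<in> permutations_of_set T" and ys: "ys \<in> permutations_of_set (A - T)"
    have lt: "\<forall>y\<in>set xs. m < y" "\<forall>y\<in>set ys. m < y"
      using T xs ys assms(2) by (auto simp: permutations_of_set_def)
    have "T = {} \<longleftrightarrow> xs = []" "T = A \<longleftrightarrow> ys = []"
      using T xs ys by (auto simp: permutations_of_set_def)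
    then show "t ^ rl_minima (xs @ m # ys) * q ^ valleys (xs @ m # ys) =
        t * (if T = {} \<or> T = A then 1 else q) * ((1 ^ rl_minima xs * q ^ valleys xs) *
        (t ^ rl_minima ys * q ^ valleys ys))"
      by (simp add: rl_minima_split_min[OF lt] valleys_split_min[OF lt] power_add mult_ac)
  qed
  also have "\<dots> = t * (\<Sum>T\<in>Pow A. (if T = {} \<or> T = A then 1 else q) *
      (word_sum 1 q T * word_sum t q (A - T)))"
    unfolding word_sum_def sum_product by (simp add: sum_distrib_left mult.assoc)
  finally show ?thesis .
qed

text \<open>Once word sums over subsets depend on cardinality alone, subsets of equal size can be
  grouped. The assumption on \<open>w\<close> is shaped to be an induction hypothesis, for both
  weights \<open>1\<close> and \<open>t\<close>.\<close>

lemma word_sum_insert_min_card: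
  assumes "finite A" "\<forall>a\<in>A. m < a"
    and w: "\<And>u B. B \<subseteq> A \<Longrightarrow> word_sum u q B = w u (card B)"
  shows "word_sum t q (insert m A) = t * (\<Sum>k\<le>card A. of_nat (card A choose k) *
     ((if k = 0 \<or> k = card A then 1 else q) * (w 1 k * w t (card A - k))))"
proof -
  have "(\<Sum>T\<in>Pow A. (if T = {} \<or> T = A then 1 else q) * (word_sum 1 q T * word_sum t q (A - T))) =
      (\<Sum>T\<in>Pow A. (if card T = 0 \<or> card T = card A then 1 else q) * (w 1 (card T) * w t (card A - card T)))"
  proof (intro sum.cong refl)
    fix T assume "T \<in> Pow A"
    then have T: "T \<subseteq> A" "finite T" using assms(1) finite_subset by auto
    have "T = A \<longleftrightarrow> card T = card A" using T assms(1) card_subset_eq by blast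
    moreover have "card (A - T) = card A - card T" using T card_Diff_subset by blast
    ultimately show "(if T = {} \<or> T = A then 1 else q) * (word_sum 1 q T * word_sum t q (A - T)) =
        (if card T = 0 \<or> card T = card A then 1 else q) * (w 1 (card T) * w t (card A - card T))"
      using T by (simp add: w)
  qed
  then show ?thesis
    unfolding word_sum_insert_min[OF assms(1,2)] by (simp only: sum_Pow_card[OF assms(1),
      of "\<lambda>c. (if c = 0 \<or> c = card A then 1 else q) * (w 1 c * w t (card A - c))"])
qed

text \<open>Both sides obey the same recursion in the cardinality, so words need not be transported
  along an order isomorphism. The weight is generalised because the recursion also involves weight
  \<open>1\<close>.\<close>

lemma word_sum_eq_if_card_eq:
  assumes "finite A" "finite B" "card A = card B"
  shows "word_sum t q A = word_sum t q B"
  using assms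
proof (induction "card A" arbitrary: A B t rule: less_induct)
  case less
  show ?case
  proof (cases "A = {}")
    case True
    then show ?thesis using less.prems by simp
  next
    case False
    then have ne: "A \<noteq> {}" "B \<noteq> {}" using less.prems by auto
    let ?w = "\<lambda>u k. word_sum u q {..<k}"
    have A: "A = insert (Min A) (A - {Min A})" and B: "B = insert (Min B) (B - {Min B})"
      using ne less.prems by (simp_all add: insert_absorb)
    have min: "\<forall>a\<in>A - {Min A}. Min A < a" "\<forall>b\<in>B - {Min B}. Min B < b"
      using less.prems by (auto simp: order.strict_iff_order)
    have card: "card (A - {Min A}) = card (B - {Min B})" "card (A - {Min A}) < card A"
      using less.prems ne by (auto simp: card_gt_0_iff)
    have w: "word_sum u q C = ?w u (card C)" if "C \<subseteq> A - {Min A} \<or> C \<subseteq> B - {Min B}" for u C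
    proof -
      have "card C \<le> card (A - {Min A})" "finite C"
        using that less.prems card(1)
          card_mono[of "A - {Min A}" C] card_mono[of "B - {Min B}" C]
          finite_subset[of C "A - {Min A}"] finite_subset[of C "B - {Min B}"] by auto
      then show ?thesis using less.hyps[of C "{..<card C}"] card(2) by simp
    qed
    have "word_sum t q (insert (Min A) (A - {Min A})) = word_sum t q (insert (Min B) (B - {Min B}))"
      using less.prems min
      by (subst (1 2) word_sum_insert_min_card[where w = ?w])
        (auto intro!: w simp only: card finite_Diff)
    then show ?thesis using A B by simp
  qed
qed

lemma word_sum_lessThan_Suc:
  "word_sum t q {..<Suc n} = t * (\<Sum>k\<le>n. of_nat (n choose k) *
     ((if k = 0 \<or> k = n then 1 else q) * (word_sum 1 q {..<k} * word_sum t q {..<n - k})))"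
proof -
  have "{..<Suc n} = insert 0 {1..n}" by auto
  moreover have "word_sum u q B = word_sum u q {..<card B}" if "B \<subseteq> {1..n}" for u B
    using that finite_subset[OF that] by (intro word_sum_eq_if_card_eq) auto
  ultimately show ?thesis
    using word_sum_insert_min_card[of "{1..n}" 0 q "\<lambda>u k. word_sum u q {..<k}" t]
    by simp
qed

section \<open>Exponential generating functions of word sums\<close>

text \<open>The empty word is left out, so that a product of two such series collects exactly the
  splittings with both sides nonempty, which carry the factor \<open>q\<close>.\<close>

definition word_egf :: "'a::field_char_0 \<Rightarrow> 'a \<Rightarrow> 'a fps" where
  "word_egf t q = Abs_fps (\<lambda>n. if n = 0 then 0 else word_sum t q {..<n} / fact n)"

lemma fps_deriv_word_egf:
  "fps_deriv (word_egf t q) = fps_const t *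
     (1 + word_egf 1 q + word_egf t q + fps_const q * word_egf 1 q * word_egf t q)"
proof (rule fps_ext)
  fix n
  let ?a = "\<lambda>k. word_sum 1 q {..<k} / fact k" and ?b = "\<lambda>k. word_sum t q {..<k} / fact k"
  let ?E = "word_egf 1 q" and ?F = "word_egf t q"
  have fact: "of_nat (n choose k) / fact n = 1 / (fact k * fact (n - k) :: 'a)" if "k \<le> n" for k
    using that by (simp add: binomial_fact)
  have "fps_deriv ?F $ n = word_sum t q {..<Suc n} / fact n"
    by (simp add: word_egf_def field_simps del: of_nat_Suc)
  also have "\<dots> = t * (\<Sum>k\<le>n. (if k = 0 \<or> k = n then 1 else q) * (?a k * ?b (n - k)))"
  proof -
    have "(\<Sum>k\<le>n. of_nat (n choose k) * ((if k = 0 \<or> k = n then 1 else q) *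
          (word_sum 1 q {..<k} * word_sum t q {..<n - k}))) / fact n =
        (\<Sum>k\<le>n. (if k = 0 \<or> k = n then 1 else q) * (?a k * ?b (n - k)))"
      unfolding sum_divide_distrib
    proof (intro sum.cong refl)
      fix k assume "k \<in> {..n}"
      then have k: "k \<le> n" by simp
      show "of_nat (n choose k) * ((if k = 0 \<or> k = n then 1 else q) *
            (word_sum 1 q {..<k} * word_sum t q {..<n - k})) / fact n =
          (if k = 0 \<or> k = n then 1 else q) * (?a k * ?b (n - k))"
        using fact[OF k] by (simp add: field_simps)
    qed
    then show ?thesis unfolding word_sum_lessThan_Suc by (simp only: times_divide_eq_right[symmetric])
  qed
  also have "(\<Sum>k\<le>n. (if k = 0 \<or> k = n then 1 else q) * (?a k * ?b (n - k))) =
      (1 + ?E + ?F + fps_const q * (?E * ?F)) $ n"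
  proof (cases "n = 0")
    case True
    then show ?thesis by (simp add: word_egf_def)
  next
    case False
    \<comment> \<open>For \<open>n > 0\<close> the terms \<open>k = 0\<close> and
      \<open>k = n\<close> are distinct and yield the two linear summands. They drop out of the
      product since both constant terms vanish. For \<open>n = 0\<close> they coincide and give the
      summand \<open>1\<close>.\<close>
    have "(\<Sum>k\<le>n. (if k = 0 \<or> k = n then 1 else q) * (?a k * ?b (n - k))) =
        (\<Sum>k\<le>n. q * (?E $ k * ?F $ (n - k)) + (if k = 0 then ?b n else 0) + (if k = n then ?a n else 0))"
      using False by (intro sum.cong refl) (auto simp: word_egf_def)
    also have "\<dots> = q * (?E * ?F) $ n + ?F $ n + ?E $ n"
      using False
      by (simp add: sum.distrib sum_distrib_left fps_mult_nth atLeast0AtMost)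
        (simp add: word_egf_def)
    finally show ?thesis
      using False by simp
  qed
  finally show "fps_deriv ?F $ n = (fps_const t * (1 + ?E + ?F + fps_const q * ?E * ?F)) $ n"
    by (simp only: fps_mult_left_const_nth mult.assoc)
qed

text \<open>The leading letter \<open>1\<close> takes part in no valley, and the other
  \<open>n\<close> letters may be relabelled.\<close>

lemma valley_poly_eq_word_sum:
  "valley_poly (Suc n) = word_sum 2 (monom 1 1) {..<n}"
proof -
  have "valley_poly (Suc n) = (\<Sum>u\<in>permutations_of_set {2..Suc n}. 2 ^ rl_minima u * monom 1 (valleys (1 # u)))"
    unfolding valley_poly_def by (rule sum_flatten_eq)
  also have "\<dots> = word_sum 2 (monom 1 1) {2..Suc n}"
    unfolding word_sum_def
  proof (intro sum.cong refl)
    fix u assume "u \<in> permutations_of_set {2..Suc n}"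
    then have "valleys (1 # u) = valleys u"
      by (intro valleys_Cons_min) (auto simp: permutations_of_set_def)
    then show "2 ^ rl_minima u * monom 1 (valleys (1 # u)) =
        2 ^ rl_minima u * monom (1::real) 1 ^ valleys u"
      by (simp add: monom_power)
  qed
  also have "\<dots> = word_sum 2 (monom 1 1) {..<n}"
    by (rule word_sum_eq_if_card_eq) auto
  finally show ?thesis .
qed

lemma fps_to_fls_sum: "fps_to_fls (\<Sum>x\<in>A. f x) = (\<Sum>x\<in>A. fps_to_fls (f x))"
  by (induction A rule: infinite_finite_induct) auto

lemma gv_Suc: "gv (Suc n) = word_sum 2 fls_X {..<n}"
proof -
  have "gv (Suc n) = (\<Sum>u\<in>permutations_of_set {..<n}. fps_to_fls (fps_of_poly (2 ^ rl_minima u * monom 1 1 ^ valleys u)))"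
    unfolding gv_def valley_poly_eq_word_sum word_sum_def
    by (simp add: fps_of_poly_sum fps_to_fls_sum)
  also have "\<dots> = word_sum 2 fls_X {..<n}"
    unfolding word_sum_def
    by (intro sum.cong refl)
      (simp add: fps_of_poly_mult fps_of_poly_power fps_of_poly_monom fls_times_fps_to_fls fps_to_fls_power
        numeral_poly fps_of_poly_const flip: fps_numeral_fps_const)
  finally show ?thesis .
qed

lemma Gv_eq_word_egf: "Gv = 1 + word_egf 2 fls_X"
  by (rule fps_ext) (auto simp: Gv_def word_egf_def gv_Suc)

subsection \<open>Formal differential equations\<close>

text \<open>Each coefficient is determined by earlier ones, so vanishing propagates. It serves as a
  uniqueness principle: the difference of two candidates is shown to satisfy such an
  equation.\<close>

lemma fps_linear_ode_zero:
  fixes f :: "'a::field_char_0 fps"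
  assumes "fps_deriv f = a * f" "f $ 0 = 0"
  shows "f = 0"
proof (rule fps_ext)
  fix n show "f $ n = 0 $ n"
  proof (induction n rule: less_induct)
    case (less n)
    show ?case
    proof (cases n)
      case 0
      then show ?thesis using assms(2) by simp
    next
      case (Suc m)
      have "of_nat (Suc m) * f $ Suc m = fps_deriv f $ m" by simp
      also have "\<dots> = (\<Sum>i=0..m. a $ i * f $ (m - i))" by (simp only: assms(1) fps_mult_nth)
      also have "\<dots> = 0" using less Suc by (intro sum.neutral) auto
      finally show ?thesis using Suc by (simp del: of_nat_Suc)
    qed
  qed
qed

section \<open>Hyperbolic functions as formal power series\<close>

lemma fps_deriv_sinh: "fps_deriv (fps_sinh s) = fps_const s * fps_cosh s"
proof -
  have "fps_deriv (2 * fps_sinh s) = fps_const s * (2 * fps_cosh s)"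
    by (simp add: fps_sinh_def fps_cosh_def algebra_simps flip: fps_const_neg)
  then show ?thesis by simp
qed

lemma fps_deriv_cosh: "fps_deriv (fps_cosh s) = fps_const s * fps_sinh s"
proof -
  have "fps_deriv (2 * fps_cosh s) = fps_const s * (2 * fps_sinh s)"
    by (simp add: fps_sinh_def fps_cosh_def algebra_simps flip: fps_const_neg)
  then show ?thesis by simp
qed


lemma fps_exp_eq_cosh_plus_sinh: "fps_exp s = fps_cosh s + fps_sinh s"
  by (simp add: fps_cosh_def fps_sinh_def flip: add_divide_distrib)

lemma fps_exp_minus_eq_cosh_minus_sinh: "fps_exp (- s) = fps_cosh s - fps_sinh s"
  by (simp add: fps_cosh_def fps_sinh_def flip: diff_divide_distrib)

lemma fps_cosh_sinh_square: "(fps_cosh s)\<^sup>2 - (fps_sinh s)\<^sup>2 = 1"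
proof -
  have "fps_exp s * fps_exp (- s) = 1"
    by (simp flip: fps_exp_add_mult)
  then show ?thesis
    by (simp add: fps_exp_eq_cosh_plus_sinh[of s] fps_exp_minus_eq_cosh_minus_sinh
        power2_eq_square algebra_simps)
qed

lemma
  shows fps_cosh_double: "fps_cosh (2 * s) = (fps_cosh s)\<^sup>2 + (fps_sinh s)\<^sup>2"
    and fps_sinh_double: "fps_sinh (2 * s) = 2 * fps_sinh s * fps_cosh s"
proof -
  have "fps_exp (2 * s) = fps_exp s * fps_exp s" "fps_exp (- (2 * s)) = fps_exp (- s) * fps_exp (- s)"
    by (simp_all flip: fps_exp_add_mult)
  then have "fps_cosh (2 * s) + fps_sinh (2 * s) = (fps_cosh s + fps_sinh s)\<^sup>2"
    and "fps_cosh (2 * s) - fps_sinh (2 * s) = (fps_cosh s - fps_sinh s)\<^sup>2"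
    by (simp_all only: fps_exp_minus_eq_cosh_minus_sinh)
      (simp_all only: fps_exp_eq_cosh_plus_sinh power2_eq_square)
  then have "2 * fps_cosh (2 * s) = (fps_cosh s + fps_sinh s)\<^sup>2 + (fps_cosh s - fps_sinh s)\<^sup>2"
    and "2 * fps_sinh (2 * s) = (fps_cosh s + fps_sinh s)\<^sup>2 - (fps_cosh s - fps_sinh s)\<^sup>2"
    by algebra+
  then have "2 * fps_cosh (2 * s) = 2 * ((fps_cosh s)\<^sup>2 + (fps_sinh s)\<^sup>2)"
    and "2 * fps_sinh (2 * s) = 2 * (2 * fps_sinh s * fps_cosh s)"
    by algebra+
  then show "fps_cosh (2 * s) = (fps_cosh s)\<^sup>2 + (fps_sinh s)\<^sup>2"
    and "fps_sinh (2 * s) = 2 * fps_sinh s * fps_cosh s"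
    by (simp_all only: mult_cancel_left) simp_all
qed

section \<open>The Riccati equation and its linear companion\<close>

text \<open>The defect \<open>U\<close> of the claimed identity satisfies a homogeneous linear
  equation whose coefficient involves \<open>P\<close> itself. Stating the solution as a product
  avoids division.\<close>

lemma fps_riccati_solution:
  fixes P :: "'a::field_char_0 fps" and s :: 'a
  defines "S \<equiv> fps_const s"
  assumes P: "fps_deriv P = 1 + 2 * P + (1 - S\<^sup>2) * P\<^sup>2" and P0: "P $ 0 = 0"
  shows "P * (S * fps_cosh s - fps_sinh s) = fps_sinh s"
proof -
  define C where "C = fps_cosh s"
  define H where "H = fps_sinh s"
  have dC: "fps_deriv C = S * H" and dH: "fps_deriv H = S * C"
    by (simp_all add: C_def H_def S_def fps_deriv_cosh fps_deriv_sinh)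
  have dS: "fps_deriv S = 0" by (simp add: S_def)
  define U where "U = P * (S * C - H) - H"
  have "fps_deriv U = (1 + 2 * P + (1 - S\<^sup>2) * P\<^sup>2) * (S * C - H) + P * (S * (S * H) - S * C) - S * C"
    by (simp add: U_def P dC dH dS algebra_simps)
  also have "\<dots> = (1 + (1 - S\<^sup>2) * P) * U"
    by (simp add: U_def algebra_simps power2_eq_square)
  finally have "fps_deriv U = (1 + (1 - S\<^sup>2) * P) * U" .
  moreover have "U $ 0 = 0" using P0 by (simp add: U_def H_def fps_sinh_def)
  ultimately have "U = 0" by (rule fps_linear_ode_zero)
  then show ?thesis by (simp add: U_def C_def H_def)
qed

text \<open>Differentiating the Riccati equation shows that \<open>fps_deriv P\<close> solves the
  homogeneous part of the equation for \<open>F\<close>. Variation of constants then suggests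
  \<open>P + fps_X * fps_deriv P\<close>, and the difference \<open>V\<close> solves the homogeneous
  equation.\<close>

lemma fps_linear_solution_of_riccati:
  fixes P F :: "'a::field_char_0 fps"
  assumes Q: "fps_deriv Q = 0"
    and P: "fps_deriv P = 1 + 2 * P + Q * P\<^sup>2" and P0: "P $ 0 = 0"
    and F: "fps_deriv F = 2 * (1 + P + F + Q * P * F)" and F0: "F $ 0 = 0"
  shows "F = P + fps_X * fps_deriv P"
proof -
  define V where "V = F - P - fps_X * fps_deriv P"
  have "fps_deriv (fps_deriv P) = fps_deriv (1 + 2 * P + Q * (P * P))"
    by (simp only: P power2_eq_square)
  also have "\<dots> = 2 * fps_deriv P + 2 * Q * P * fps_deriv P"
    by (simp add: Q algebra_simps)
  finally have dd: "fps_deriv (fps_deriv P) = 2 * fps_deriv P + 2 * Q * P * fps_deriv P" .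
  have "fps_deriv V = fps_deriv F - fps_deriv P - fps_deriv P - fps_X * fps_deriv (fps_deriv P)"
    by (simp add: V_def algebra_simps)
  also have "\<dots> = 2 * (1 + P + F + Q * P * F) - 2 * (1 + 2 * P + Q * P\<^sup>2)
      - fps_X * (2 * fps_deriv P + 2 * Q * P * fps_deriv P)"
    by (simp only: dd F) (simp add: P)
  also have "\<dots> = (2 * (1 + Q * P)) * V"
    by (simp add: V_def algebra_simps power2_eq_square)
  finally have "fps_deriv V = (2 * (1 + Q * P)) * V" .
  moreover have "V $ 0 = 0" using P0 F0 by (simp add: V_def)
  ultimately have "V = 0" by (rule fps_linear_ode_zero)
  then show ?thesis by (simp add: V_def algebra_simps)
qed

lemma fps_closed_form:
  fixes P :: "'a::field_char_0 fps" and s :: 'a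
  defines "S \<equiv> fps_const s"
  assumes s: "s \<noteq> 0"
    and P: "fps_deriv P = 1 + 2 * P + (1 - S\<^sup>2) * P\<^sup>2" and P0: "P $ 0 = 0"
  shows "1 + P + fps_X * fps_deriv P =
    S * (- fps_sinh (2 * s) + S * fps_cosh (2 * s) + 2 * S * fps_X + S)
      / (2 * (- fps_sinh s + S * fps_cosh s)\<^sup>2)"
proof -
  define C where "C = fps_cosh s"
  define H where "H = fps_sinh s"
  define D where "D = S * C - H"
  have PD: "P * D = H"
    using fps_riccati_solution[OF P[unfolded S_def] P0] by (simp add: D_def C_def H_def S_def)
  have sq: "C\<^sup>2 - H\<^sup>2 = 1" by (simp add: C_def H_def fps_cosh_sinh_square)
  have "D $ 0 = s" by (simp add: D_def C_def H_def S_def fps_cosh_def fps_sinh_def)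
  then have D0: "D \<noteq> 0" using s by auto
  \<comment> \<open>Multiplying the Riccati equation by \<open>D\<^sup>2\<close> leaves only the
    known product \<open>P * D = H\<close>.\<close>
  have "fps_deriv P * D\<^sup>2 = D\<^sup>2 + 2 * (P * D) * D + (1 - S\<^sup>2) * (P * D)\<^sup>2"
    by (simp add: P algebra_simps power2_eq_square)
  also have "\<dots> = S\<^sup>2 * (C\<^sup>2 - H\<^sup>2)"
    unfolding PD by (simp add: D_def algebra_simps power2_eq_square)
  finally have dPD: "fps_deriv P * D\<^sup>2 = S\<^sup>2" by (simp add: sq)
  have "(1 + P + fps_X * fps_deriv P) * (2 * D\<^sup>2) =
      2 * D\<^sup>2 + 2 * (P * D) * D + 2 * fps_X * (fps_deriv P * D\<^sup>2)"
    by (simp add: algebra_simps power2_eq_square)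
  also have "\<dots> = 2 * S\<^sup>2 * C\<^sup>2 - S * (2 * H * C) + 2 * S\<^sup>2 * fps_X"
    unfolding PD dPD by (simp add: D_def algebra_simps power2_eq_square)
  \<comment> \<open>The sum of squares becomes \<open>fps_cosh (2 * s)\<close>, and the difference,
    equal to \<open>1\<close>, gives the isolated \<open>S\<close> in the numerator.\<close>
  also have "2 * S\<^sup>2 * C\<^sup>2 = S\<^sup>2 * (C\<^sup>2 + H\<^sup>2 + (C\<^sup>2 - H\<^sup>2))"
    by (simp add: algebra_simps)
  also have "\<dots> - S * (2 * H * C) + 2 * S\<^sup>2 * fps_X =
      S * (- (2 * H * C) + S * (C\<^sup>2 + H\<^sup>2) + 2 * S * fps_X + S)"
    unfolding sq by (simp add: algebra_simps power2_eq_square)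
  finally have "(1 + P + fps_X * fps_deriv P) * (2 * D\<^sup>2) =
      S * (- fps_sinh (2 * s) + S * fps_cosh (2 * s) + 2 * S * fps_X + S)"
    by (simp add: fps_cosh_double fps_sinh_double C_def H_def)
  moreover have "2 * D\<^sup>2 = 2 * (- fps_sinh s + S * fps_cosh s)\<^sup>2"
    by (simp add: D_def C_def H_def)
  moreover have "2 * D\<^sup>2 \<noteq> 0" using D0 by simp
  ultimately show ?thesis by (metis nonzero_mult_div_cancel_right)
qed

text \<open>The constant \<open>- 1 / (1 + s)\<close> also solves the Riccati equation. Subtracting
  it from \<open>P\<close> and rescaling leaves a series \<open>Y\<close> with
  \<open>Y = exp (2 s x) / (1 - r exp (2 s x))\<close>, stated here without division.\<close>

lemma fps_riccati_exponential:
  fixes P :: "'a::field_char_0 fps" and s :: 'a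
  defines "S \<equiv> fps_const s"
  assumes s: "s \<noteq> 0" "1 + s \<noteq> 0"
    and P: "fps_deriv P = 1 + 2 * P + (1 - S\<^sup>2) * P\<^sup>2" and P0: "P $ 0 = 0"
  shows "fps_const ((1 + s) / (2 * s)) * (1 + fps_const (1 + s) * P) *
    (1 - fps_const ((1 - s) / (1 + s)) * fps_exp (2 * s)) = fps_exp (2 * s)"
proof -
  define C where "C = fps_cosh s"
  define H where "H = fps_sinh s"
  define D where "D = S * C - H"
  have PD: "P * D = H"
    using fps_riccati_solution[OF P[unfolded S_def] P0] by (simp add: D_def C_def H_def S_def)
  have sq: "C\<^sup>2 - H\<^sup>2 = 1" by (simp add: C_def H_def fps_cosh_sinh_square)
  have e: "fps_exp (2 * s) = (C + H)\<^sup>2"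
    by (simp only: fps_exp_eq_cosh_plus_sinh fps_cosh_double fps_sinh_double)
      (simp add: C_def H_def algebra_simps power2_eq_square)
  define r where "r = fps_const ((1 - s) / (1 + s))"
  define k where "k = fps_const ((1 + s) / (2 * s))"
  have k: "2 * S * k = 1 + S" and r: "(1 + S) * r = 1 - S"
    using s by (simp_all add: S_def r_def k_def fps_numeral_fps_const flip: fps_const_1_eq_1)
  have S1: "fps_const (1 + s) = 1 + S" by (simp add: S_def flip: fps_const_1_eq_1)
  have "2 * S * (1 + S) * (k * (1 + fps_const (1 + s) * P) * (1 - r * fps_exp (2 * s))) =
      (2 * S * k) * (1 + (1 + S) * P) * ((1 + S) - (1 + S) * r * (C + H)\<^sup>2)"
    unfolding S1 e by (simp add: algebra_simps)
  \<comment> \<open>Replacing \<open>1\<close> by \<open>C\<^sup>2 - H\<^sup>2\<close> lets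
    \<open>C + H\<close> be factored out, with cofactor \<open>2 * D\<close>.\<close>
  also have "\<dots> = (1 + S) * (1 + (1 + S) * P) * ((1 + S) * (C\<^sup>2 - H\<^sup>2) - (1 - S) * (C + H)\<^sup>2)"
    unfolding k r sq by simp
  also have "\<dots> = 2 * (1 + S) * (C + H) * (D + (1 + S) * (P * D))"
    by (simp add: D_def algebra_simps power2_eq_square)
  also have "\<dots> = 2 * S * (1 + S) * (C + H)\<^sup>2"
    unfolding PD by (simp add: D_def algebra_simps power2_eq_square)
  finally have "2 * S * (1 + S) * (k * (1 + fps_const (1 + s) * P) * (1 - r * fps_exp (2 * s))) =
      2 * S * (1 + S) * fps_exp (2 * s)" by (simp only: e)
  moreover have "2 * S * (1 + S) \<noteq> 0"
    using s by (simp add: S_def flip: fps_const_1_eq_1)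
  ultimately show ?thesis by (simp only: mult_cancel_left k_def r_def) simp
qed

subsection \<open>Expansion as an infinite sum\<close>

text \<open>Shifting the summation index by one and expanding the power of the successor binomially
  gives the recurrence; the extra term on the left is the last one of the longer sum.\<close>

lemma geometric_power_sum_recurrence:
  fixes r :: "'a::comm_semiring_1"
  shows "(\<Sum>i<M. of_nat (Suc i) ^ n * r ^ i) + of_nat (Suc M) ^ n * r ^ M =
    1 + r * (\<Sum>k\<le>n. of_nat (n choose k) * (\<Sum>i<M. of_nat (Suc i) ^ k * r ^ i))"
proof (induction M)
  case 0
  then show ?case by simp
next
  case (Suc M)
  have "of_nat (Suc (Suc M)) ^ n = (of_nat (Suc M) + 1 :: 'a) ^ n" by (simp add: add.commute)
  also have "\<dots> = (\<Sum>k\<le>n. of_nat (n choose k) * of_nat (Suc M) ^ k)"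
    by (simp only: binomial_ring power_one mult_1_right)
  finally have bin: "of_nat (Suc (Suc M)) ^ n * r ^ Suc M =
      r * (\<Sum>k\<le>n. of_nat (n choose k) * (of_nat (Suc M) ^ k * r ^ M))"
    by (simp only: sum_distrib_left sum_distrib_right power_Suc) (simp only: mult_ac)
  show ?case
    unfolding sum.lessThan_Suc bin Suc.IH
    by (simp only: sum.distrib distrib_left add.assoc)
qed

text \<open>Comparison of coefficients in \<open>Y = exp (c x) + r Y exp (c x)\<close>. Formally
  \<open>Y\<close> is the sum of \<open>r ^ i * exp (c (i + 1) x)\<close>, so \<open>Z n\<close>
  stands for the sum of \<open>(i + 1) ^ n * r ^ i\<close>.\<close>

lemma fps_exp_geometric_coeff:
  fixes Y :: "'a::field_char_0 fps"
  assumes Y: "Y * (1 - fps_const r * fps_exp c) = fps_exp c" and c: "c \<noteq> 0"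
    and Z: "\<And>n. Z n = Y $ n * fact n / c ^ n"
  shows "Z n = 1 + r * (\<Sum>k\<le>n. of_nat (n choose k) * Z k)"
proof -
  have "Y = fps_exp c + fps_const r * (Y * fps_exp c)"
    using Y by (simp add: algebra_simps)
  then have "Y $ n = (fps_exp c + fps_const r * (Y * fps_exp c)) $ n" by simp
  also have "\<dots> = c ^ n / fact n + r * (\<Sum>k\<le>n. Y $ k * (c ^ (n - k) / fact (n - k)))"
    by (simp add: fps_mult_nth[of Y] atLeast0AtMost)
  finally have "Z n = (c ^ n / fact n + r * (\<Sum>k\<le>n. Y $ k * (c ^ (n - k) / fact (n - k)))) * (fact n / c ^ n)"
    by (simp add: Z)
  also have "\<dots> = 1 + r * (\<Sum>k\<le>n. Y $ k * (c ^ (n - k) / fact (n - k)) * (fact n / c ^ n))"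
  proof -
    have "(c ^ n / fact n + r * x) * (fact n / c ^ n) = 1 + r * (x * (fact n / c ^ n))" for x
      using c by (simp add: field_simps)
    then show ?thesis by (simp only: sum_distrib_right)
  qed
  also have "(\<Sum>k\<le>n. Y $ k * (c ^ (n - k) / fact (n - k)) * (fact n / c ^ n)) =
      (\<Sum>k\<le>n. of_nat (n choose k) * Z k)"
  proof (intro sum.cong refl)
    fix k assume "k \<in> {..n}"
    then have "of_nat (n choose k) = (fact n / (fact k * fact (n - k)) :: 'a)"
      and "c ^ n = c ^ (n - k) * c ^ k"
      by (simp_all add: binomial_fact flip: power_add)
    then show "Y $ k * (c ^ (n - k) / fact (n - k)) * (fact n / c ^ n) = of_nat (n choose k) * Z k"
      using c by (simp add: Z field_simps)
  qed
  finally show ?thesis .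
qed

text \<open>As \<open>\<rho>\<close> has no constant term, a power series multiple of
  \<open>\<rho> ^ M\<close> is zero or has order at least \<open>M\<close>, hence norm at most
  \<open>(1 / 2) ^ M\<close>.\<close>

lemma fls_tendsto_if_diff_power:
  fixes a :: "'a::field fls"
  assumes \<rho>: "\<rho> $ 0 = 0" and diff: "\<And>M. \<exists>E. a - b M = fps_to_fls (\<rho> ^ M * E)"
  shows "b \<longlonglongrightarrow> a"
proof -
  have "dist a (b M) \<le> (1 / 2) ^ M" for M
  proof (cases "a = b M")
    case False
    obtain E where E: "a - b M = fps_to_fls (\<rho> ^ M * E)" using diff by blast
    then have nz: "\<rho> ^ M * E \<noteq> 0"
      using False by (metis eq_iff_diff_eq_0 fps_to_fls_eq_0_iff)
    have "M \<le> subdegree (\<rho> ^ M)"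
    proof (cases "M = 0")
      case False
      then have "\<rho> \<noteq> 0" using nz by (auto simp: power_0_left)
      then have "subdegree \<rho> \<noteq> 0" using \<rho> by (simp add: subdegree_eq_0_iff)
      then show ?thesis by simp
    qed simp
    then have "M \<le> subdegree (\<rho> ^ M * E)"
      using nz by (metis mult_eq_0_iff subdegree_mult trans_le_add1)
    moreover have "fls_subdegree (a - b M) = int (subdegree (\<rho> ^ M * E))"
      unfolding E by (rule fls_subdegree_fls_to_fps)
    ultimately have "M \<le> nat (fls_subdegree (a - b M))" "fls_subdegree (a - b M) \<ge> 0" by auto
    moreover then have "(2::real) ^ M \<le> 2 ^ nat (fls_subdegree (a - b M))" by simp
    ultimately show ?thesis
      using False by (simp add: dist_fls_def power_one_over field_simps)
  qed simp
  then have dist: "dist (b M) a \<le> dist ((1 / 2 :: real) ^ M) 0" for M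
    by (simp add: dist_commute[of "b M" a])
  have "(\<lambda>M. (1 / 2 :: real) ^ M) \<longlonglongrightarrow> 0" by (rule LIMSEQ_realpow_zero) auto
  then show ?thesis
    by (rule metric_tendsto_imp_tendsto) (intro always_eventually allI dist)
qed

text \<open>
  The partial sums satisfy the recurrence of \<open>Z\<close> up to a multiple of \<open>\<rho>\<^sup>M\<close>.  This error is all
  that has to be estimated, so that no continuity of the operations on \<^typ>\<open>real fls\<close> is needed.
\<close>

lemma fls_geometric_power_sums:
  fixes Z :: "nat \<Rightarrow> 'a::field fls"
  assumes \<rho>: "\<rho> $ 0 = 0"
    and Z: "\<And>n. Z n = 1 + fps_to_fls \<rho> * (\<Sum>k\<le>n. of_nat (n choose k) * Z k)"
  shows "(\<lambda>i. of_nat (Suc i) ^ n * fps_to_fls \<rho> ^ i * fps_to_fls c) sums (Z n * fps_to_fls c)"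
proof -
  define r where "r = fps_to_fls \<rho>"
  define T where "T M n = (\<Sum>i<M. of_nat (Suc i) ^ n * r ^ i)" for M n
  have T: "T M n + of_nat (Suc M) ^ n * r ^ M = 1 + r * (\<Sum>k\<le>n. of_nat (n choose k) * T M k)" for M n
    unfolding T_def by (rule geometric_power_sum_recurrence)
  have of_nat: "fps_to_fls (of_nat m :: 'a fps) = of_nat m" for m
    by (induction m) auto
  have sum: "fps_to_fls (sum g A) = (\<Sum>x\<in>A. fps_to_fls (g x))" for g and A :: "nat set"
    by (rule fps_to_fls_sum)
  have \<rho>1: "(1 - \<rho>) * inverse (1 - \<rho>) = 1"
    using \<rho> by (intro inverse_mult_eq_1') simp
  have r1: "(1 - r) * fps_to_fls (inverse (1 - \<rho>)) = 1"
    using arg_cong[OF \<rho>1, of fps_to_fls] by (simp add: fls_times_fps_to_fls r_def)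
  \<comment> \<open>The cofactor must be a power series, since negative powers could offset the
    order of \<open>r ^ M\<close>.\<close>
  have "\<exists>E. Z n - T M n = r ^ M * fps_to_fls E" for n M
  proof (induction n rule: less_induct)
    case (less n)
    then obtain E where E: "\<And>k. k < n \<Longrightarrow> Z k - T M k = r ^ M * fps_to_fls (E k)"
      by metis
    define E' where "E' = of_nat (Suc M) ^ n + \<rho> * (\<Sum>k<n. of_nat (n choose k) * E k)"
    have "Z n - T M n = of_nat (Suc M) ^ n * r ^ M + r * (\<Sum>k\<le>n. of_nat (n choose k) * (Z k - T M k))"
    proof -
      have "(\<Sum>k\<le>n. of_nat (n choose k) * (Z k - T M k)) =
          (\<Sum>k\<le>n. of_nat (n choose k) * Z k) - (\<Sum>k\<le>n. of_nat (n choose k) * T M k)"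
        by (simp add: right_diff_distrib sum_subtractf)
      moreover have gen: "z - t = d + r * (x - y)" if "z = 1 + r * x" "t + d = 1 + r * y" for z t d x y :: "'a fls"
      proof -
        have "t = 1 + r * y - d" using that(2) by (simp only: eq_diff_eq)
        then show ?thesis by (simp add: that(1) right_diff_distrib)
      qed
      ultimately show ?thesis using gen[OF Z[folded r_def, of n] T[of M n]] by (simp only:)
    qed
    also have "(\<Sum>k\<le>n. of_nat (n choose k) * (Z k - T M k)) =
        (\<Sum>k<n. of_nat (n choose k) * (Z k - T M k)) + (Z n - T M n)"
      by (simp flip: lessThan_Suc_atMost)
    also have "(\<Sum>k<n. of_nat (n choose k) * (Z k - T M k)) =
        r ^ M * (\<Sum>k<n. of_nat (n choose k) * fps_to_fls (E k))"
      unfolding sum_distrib_left by (intro sum.cong refl) (simp add: E)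
    \<comment> \<open>The recurrence is implicit: its summand \<open>k = n\<close> moves to the left
      and produces \<open>1 - r\<close>, whose inverse is again a power series.\<close>
    finally have "(1 - r) * (Z n - T M n) = r ^ M * (of_nat (Suc M) ^ n +
        r * (\<Sum>k<n. of_nat (n choose k) * fps_to_fls (E k)))"
      by (simp add: algebra_simps)
    also have "\<dots> = r ^ M * fps_to_fls E'"
      by (simp add: E'_def r_def of_nat sum fls_times_fps_to_fls fps_to_fls_power del: of_nat_Suc)
    finally have "((1 - r) * fps_to_fls (inverse (1 - \<rho>))) * (Z n - T M n) =
        r ^ M * fps_to_fls (E' * inverse (1 - \<rho>))"
      by (simp add: fls_times_fps_to_fls mult_ac)
    then show ?case unfolding r1 by auto
  qed
  then obtain E where E: "Z n - T M n = r ^ M * fps_to_fls (E M)" for M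
    by metis
  have "Z n * fps_to_fls c - (\<Sum>i<M. of_nat (Suc i) ^ n * r ^ i * fps_to_fls c) =
      fps_to_fls (\<rho> ^ M * (E M * c))" for M
  proof -
    have "Z n * fps_to_fls c - (\<Sum>i<M. of_nat (Suc i) ^ n * r ^ i * fps_to_fls c) =
        (Z n - T M n) * fps_to_fls c"
      unfolding T_def left_diff_distrib sum_distrib_right ..
    then show ?thesis
      unfolding E by (simp add: r_def fls_times_fps_to_fls fps_to_fls_power mult_ac)
  qed
  then have "(\<lambda>M. \<Sum>i<M. of_nat (Suc i) ^ n * r ^ i * fps_to_fls c) \<longlonglongrightarrow> Z n * fps_to_fls c"
    by (intro fls_tendsto_if_diff_power[OF \<rho>]) blast
  then show ?thesis by (simp add: sums_def r_def)
qed

section \<open>The square root of \<open>1 - q\<close> and the two formulas\<close>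

lemma
  shows sqrt_theta_nonzero: "sqrt_theta \<noteq> 0"
    and one_plus_sqrt_theta_nonzero: "1 + sqrt_theta \<noteq> 0"
proof -
  let ?\<sigma> = "fps_radical root 2 (1 - fps_X :: real fps)"
  have "?\<sigma> $ 0 = 1" "(1 + ?\<sigma>) $ 0 = 2" by simp_all
  then have "?\<sigma> \<noteq> 0" "1 + ?\<sigma> \<noteq> 0"
    by (metis fps_zero_nth zero_neq_one, metis fps_zero_nth zero_neq_numeral)
  moreover have "1 + sqrt_theta = fps_to_fls (1 + ?\<sigma>)" by (simp add: sqrt_theta_def)
  ultimately show "sqrt_theta \<noteq> 0" "1 + sqrt_theta \<noteq> 0"
    by (simp add: sqrt_theta_def, simp only: fps_to_fls_eq_0_iff) simp
qed

theorem theorem3p14: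
  shows "(let s = sqrt_theta; S = fps_const s in
           Gv = S * (- fps_sinh (2 * s) + S * fps_cosh (2 * s) + 2 * S * fps_X + S)
                / (2 * (- fps_sinh s + S * fps_cosh s)\<^sup>2))
       \<and> (\<forall>n\<ge>2. let s = sqrt_theta;
                     f = (\<lambda>j. of_nat j ^ (n - 1) * ((1 - s) ^ (j - 1) / (1 + s) ^ (j + 1)))
                 in summable (\<lambda>i. f (Suc i)) \<and>
                    gv n = of_nat n * (2 * s) ^ n * (\<Sum>i. f (Suc i)))"
proof -
  define s where "s = sqrt_theta"
  define S where "S = fps_const s"
  define P where "P = word_egf 1 (fls_X :: real fls)"
  define F where "F = word_egf 2 (fls_X :: real fls)"
  have s0: "s \<noteq> 0" "1 + s \<noteq> 0"
    by (simp_all add: s_def sqrt_theta_nonzero one_plus_sqrt_theta_nonzero)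
  have X: "fls_X = 1 - s\<^sup>2" using sqrt_theta_squared by (simp add: s_def)
  have Q: "fps_const (fls_X :: real fls) = 1 - S\<^sup>2"
    by (simp add: X S_def flip: fps_const_1_eq_1)
  have P0: "P $ 0 = 0" and F0: "F $ 0 = 0" by (simp_all add: P_def F_def word_egf_def)
  have P: "fps_deriv P = 1 + 2 * P + (1 - S\<^sup>2) * P\<^sup>2"
    using fps_deriv_word_egf[of 1 "fls_X :: real fls"] unfolding Q P_def[symmetric]
    by (simp add: algebra_simps power2_eq_square)
  have F: "fps_deriv F = 2 * (1 + P + F + (1 - S\<^sup>2) * P * F)"
    using fps_deriv_word_egf[of 2 "fls_X :: real fls"] unfolding Q P_def[symmetric] F_def[symmetric]
    by (simp flip: fps_numeral_fps_const)
  have FP: "F = P + fps_X * fps_deriv P"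
    by (rule fps_linear_solution_of_riccati[OF _ P P0 F F0]) (simp add: S_def)
  have "Gv = 1 + P + fps_X * fps_deriv P"
    unfolding Gv_eq_word_egf F_def[symmetric] FP by simp
  also have "\<dots> = S * (- fps_sinh (2 * s) + S * fps_cosh (2 * s) + 2 * S * fps_X + S)
      / (2 * (- fps_sinh s + S * fps_cosh s)\<^sup>2)"
    unfolding S_def by (rule fps_closed_form[OF s0(1) P[unfolded S_def] P0])
  finally have closed: "Gv = \<dots>" .

  define r where "r = (1 - s) / (1 + s)"
  define Y where "Y = fps_const ((1 + s) / (2 * s)) * (1 + fps_const (1 + s) * P)"
  define Z where "Z n = Y $ n * fact n / (2 * s) ^ n" for n
  have Y: "Y * (1 - fps_const r * fps_exp (2 * s)) = fps_exp (2 * s)"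
    unfolding Y_def r_def by (rule fps_riccati_exponential[OF s0 P[unfolded S_def] P0])
  have Zrec: "Z n = 1 + r * (\<Sum>k\<le>n. of_nat (n choose k) * Z k)" for n
    by (rule fps_exp_geometric_coeff[OF Y _ Z_def]) (simp add: s0)
  define \<sigma> where "\<sigma> = fps_radical root 2 (1 - fps_X :: real fps)"
  have s\<sigma>: "s = fps_to_fls \<sigma>" by (simp add: s_def sqrt_theta_def \<sigma>_def)
  have \<sigma>0: "\<sigma> $ 0 = 1" by (simp add: \<sigma>_def)
  then have "inverse (fps_to_fls (1 + \<sigma>)) = fps_to_fls (inverse (1 + \<sigma>))"
    by (intro fls_inverse_fps_to_fls) (simp add: subdegree_eq_0_iff)
  then have inv: "inverse (1 + s) = fps_to_fls (inverse (1 + \<sigma>))" by (simp add: s\<sigma>)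
  \<comment> \<open>The ratio \<open>r\<close> as a power series in \<open>q\<close>. Its constant
    term vanishes because that of \<open>\<sigma>\<close> is \<open>1\<close>, which makes the
    geometric series converge.\<close>
  define \<rho> where "\<rho> = (1 - \<sigma>) * inverse (1 + \<sigma>)"
  have r\<rho>: "r = fps_to_fls \<rho>"
    unfolding r_def divide_inverse inv \<rho>_def by (simp add: s\<sigma> fls_times_fps_to_fls)
  have \<rho>0: "\<rho> $ 0 = 0" using \<sigma>0 by (simp add: \<rho>_def)
  have c: "fps_to_fls ((inverse (1 + \<sigma>))\<^sup>2) = 1 / (1 + s)\<^sup>2"
    unfolding fps_to_fls_power inv[symmetric] by (simp add: field_simps)
  have sums: "(\<lambda>i. of_nat (Suc i) ^ m * ((1 - s) ^ i / (1 + s) ^ (i + 2))) sums (Z m / (1 + s)\<^sup>2)" for m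
  proof -
    have "(\<lambda>i. of_nat (Suc i) ^ m * r ^ i * (1 / (1 + s)\<^sup>2)) sums (Z m * (1 / (1 + s)\<^sup>2))"
      using fls_geometric_power_sums[OF \<rho>0 Zrec[unfolded r\<rho>], of m "(inverse (1 + \<sigma>))\<^sup>2"]
      unfolding c r\<rho>[symmetric] .
    then show ?thesis
      by (simp add: r_def power_divide power_add power2_eq_square mult_ac del: of_nat_Suc)
  qed
  \<comment> \<open>For \<open>m \<ge> 1\<close> the constants that separate \<open>Y\<close> from a
    multiple of \<open>P\<close> do not matter; this is the origin of the bound
    \<open>n \<ge> 2\<close>.\<close>
  have gv: "gv (Suc m) = of_nat (Suc m) * (2 * s) ^ Suc m * (Z m / (1 + s)\<^sup>2)" if "m \<ge> 1" for m
  proof -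
    have "gv (Suc m) = fact m * F $ m"
      using that by (simp add: gv_Suc F_def word_egf_def)
    \<comment> \<open>The coefficient of \<open>P + fps_X * fps_deriv P\<close> supplies the factor
      \<open>n\<close> of the formula, with \<open>n = Suc m\<close>.\<close>
    also have "F $ m = of_nat (Suc m) * P $ m"
      using that unfolding FP by (cases m) (simp_all add: algebra_simps)
    finally have "gv (Suc m) = fact m * (of_nat (Suc m) * P $ m)" .
    moreover have "Y $ m = (1 + s)\<^sup>2 / (2 * s) * P $ m"
      using that by (simp add: Y_def power2_eq_square mult.assoc)
    then have "P $ m = 2 * s / (1 + s)\<^sup>2 * Y $ m" using s0 by (simp add: field_simps)
    moreover have "Y $ m = Z m * (2 * s) ^ m / fact m" using s0 by (simp add: Z_def)
    ultimately show ?thesis by (simp del: of_nat_Suc)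
  qed
  have series: "summable (\<lambda>i. of_nat (Suc i) ^ (n - 1) * ((1 - s) ^ (Suc i - 1) / (1 + s) ^ (Suc i + 1)))
      \<and> gv n = of_nat n * (2 * s) ^ n *
          (\<Sum>i. of_nat (Suc i) ^ (n - 1) * ((1 - s) ^ (Suc i - 1) / (1 + s) ^ (Suc i + 1)))"
    if n: "n \<ge> 2" for n
  proof -
    have sum: "(\<lambda>i. of_nat (Suc i) ^ (n - 1) * ((1 - s) ^ (Suc i - 1) / (1 + s) ^ (Suc i + 1)))
        sums (Z (n - 1) / (1 + s)\<^sup>2)"
      using sums[of "n - 1"] by simp
    have "Suc (n - 1) = n" "n - 1 \<ge> 1" using n by auto
    then have "gv n = of_nat n * (2 * s) ^ n * (Z (n - 1) / (1 + s)\<^sup>2)"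
      using gv[of "n - 1"] by (simp only:)
    then show ?thesis
      unfolding sums_unique[OF sum] using sums_summable[OF sum] by (rule conjI[rotated])
  qed
  show ?thesis
    unfolding Let_def s_def[symmetric] S_def[symmetric]
    by (rule conjI[OF closed], intro allI impI, rule series)
qed

end
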